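(* Let $t$ be a positive integer and suppose $P(2^t-1)>2^{0.75\,t}$. Then there exist a constant $c>0$ and constants $\delta>0$, $\epsilon<1/2$ such that for every message length $n\ge 1$ there is a binary code $C_n:\{0,1\}^n\to\{0,1\}^{N_n}$ with $N_n\le e^{c\,n^{1/t}}$ which is $(3,\delta,\epsilon)$-locally decodable. (That is: for every message length $n$ there exists a three query locally decodable code of length $\exp(n^{1/t})$.)
   Context: $P(m)$ denotes the largest prime factor of the integer $m$. For binary strings, $d_H$ is Hamming distance. A binary code $C:\{0,1\}^n\to\{0,1\}^N$ is $(k,\delta,\epsilon)$-locally decodable if there is a randomized algorithm $\mathcal A$ which, given an index $i\in[n]$ and oracle access to a string $y\in\{0,1\}^N$, makes at most $k$ queries to $y$, and satisfies $\Pr[\mathcal A^y(i)=x_i]\ge 1-\epsilon$ for all $x\in\{0,1\}^n$, all $i\in[n]$ and all $y\in\{0,1\}^N$ with $d_H(C(x),y)\le \delta N$ (probability over the coin tosses of $\mathcal A$). The notation $\exp(x)$ means $e^{O(x)}$. *)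

theory Defs
  imports "HOL-Probability.Probability" "HOL-Computational_Algebra.Primes"
begin

(* Convention: the value is 1 if m has no prime factor, in particular for m = 1. *)
definition largest_prime_factor :: "nat \<Rightarrow> nat" where
  "largest_prime_factor m = (if prime_factors m = {} then 1 else Max (prime_factors m))"

definition bitstrings :: "nat \<Rightarrow> bool list set" where
  "bitstrings n = {x. length x = n}"

(* Only meaningful for strings of equal length, which is the only case used below. *)
definition hamming_dist :: "bool list \<Rightarrow> bool list \<Rightarrow> nat" where
  "hamming_dist x y = card {j. j < length x \<and> x ! j \<noteq> y ! j}"

(* A deterministic, possibly adaptive, computation with access to an oracle string: each query
   may depend on the answers to the previous ones. *)
datatype oracle_alg = Output bool | Query nat "bool \<Rightarrow> oracle_alg"

primrec run :: "oracle_alg \<Rightarrow> bool list \<Rightarrow> bool" where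
  "run (Output b) y = b"
| "run (Query j next_step) y = run (next_step (y ! j)) y"

primrec queries :: "oracle_alg \<Rightarrow> bool list \<Rightarrow> nat list" where
  "queries (Output b) y = []"
| "queries (Query j next_step) y = j # queries (next_step (y ! j)) y"

(* A randomized oracle algorithm is a probability distribution on deterministic ones (all coins
   are tossed in advance). The bound on the number of queries, and the requirement that queried
   positions exist, hold for every oracle string and every outcome of the coin tosses.
   Positions are counted from 0, so the index set [n] is {..<n}. *)
definition locally_decodable ::
  "nat \<Rightarrow> nat \<Rightarrow> (bool list \<Rightarrow> bool list) \<Rightarrow> nat \<Rightarrow> real \<Rightarrow> real \<Rightarrow> bool" where
  "locally_decodable n N C k \<delta> \<epsilon> \<longleftrightarrow>
     (\<exists>A :: nat \<Rightarrow> oracle_alg pmf.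
        (\<forall>i<n. \<forall>T\<in>set_pmf (A i). \<forall>y\<in>bitstrings N.
            length (queries T y) \<le> k \<and> set (queries T y) \<subseteq> {..<N}) \<and>
        (\<forall>x\<in>bitstrings n. \<forall>i<n. \<forall>y\<in>bitstrings N.
            real (hamming_dist (C x) y) \<le> \<delta> * real N \<longrightarrow>
            measure_pmf.prob (A i) {T. run T y = x ! i} \<ge> 1 - \<epsilon>))"

end

theory Submission
  imports "HOL-Number_Theory.Residue_Primitive_Roots" "HOL-Library.Z2"
    "HOL-Computational_Algebra.Polynomial_Factorial" Defs
begin

text \<open>
  The codewords are built from vectors over the integers modulo \<open>p = P(2^t - 1)\<close>. Message
  bit \<open>i\<close> is represented by vectors \<open>u\<^sub>i, v\<^sub>i\<close> with \<open>u\<^sub>i \<cdot> v\<^sub>i = 0\<close> and \<open>u\<^sub>j \<cdot> v\<^sub>i\<close> a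
  power of 2 for \<open>i \<noteq> j\<close>, and bit \<open>w\<close> of the codeword of \<open>x\<close> is the parity of the sum
  of the \<open>x\<^sub>j f(u\<^sub>j \<cdot> w)\<close>, for a 0-1-valued function \<open>f\<close> with \<open>f(0) = 1\<close> whose values at
  \<open>a + 2^k s\<^sub>0\<close>, \<open>a + 2^k s\<^sub>1\<close>, \<open>a + 2^k s\<^sub>2\<close> always have even sum. To decode \<open>x\<^sub>i\<close>, add
  up the bits at \<open>w + s\<^sub>l v\<^sub>i\<close> for a random \<open>w\<close> orthogonal to \<open>u\<^sub>i\<close>.

  Let \<open>g\<close> be an irreducible factor of \<open>(x^p - 1)/(x - 1)\<close> over the field with 2 elements, so
  that \<open>x\<close> has order \<open>p\<close> modulo \<open>g\<close>. Since \<open>p\<close> divides \<open>2^t - 1\<close>, all elements of the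
  residue field of \<open>g\<close> are roots of \<open>y^(2^t) - y\<close>, so there are at most \<open>2^t\<close> of them. If three
  powers \<open>x^s\<^sub>0\<close>, \<open>x^s\<^sub>1\<close>, \<open>x^s\<^sub>2\<close> have sum 0 modulo \<open>g\<close>, then one can take for \<open>f(m)\<close> the
  constant coefficient of \<open>x^m mod g\<close>, because squaring is additive. Such powers are found by
  counting with additive characters. As \<open>\<eta>(a)\<close>, the sum of a character over the multiple
  \<open>a G\<close> of the group \<open>G\<close> of powers of \<open>x\<close>, depends only on \<open>a G\<close>, Parseval gives
  \<open>\<bar>\<eta>(a)\<bar> \<le> 2^(t/2)\<close> for \<open>a \<noteq> 0\<close>, which makes the term \<open>\<eta>(0)^3 = p^3\<close> dominate when
  \<open>p > 2^(3t/4)\<close>.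

  For the vectors, start from words of length \<open>p - 1\<close> over an alphabet of size \<open>r\<close>, where
  Hamming distances are inner products and nonzero modulo \<open>p\<close> for distinct words. The
  \<open>(p - 1)/t\<close>-th tensor power turns these inner products into powers of 2, because 2 has order
  \<open>t\<close> modulo \<open>p\<close>. Hence \<open>r^(p - 1)\<close> message bits need only dimension
  \<open>((p - 1) r)^((p - 1)/t)\<close>.
\<close>

lemmas cong_mod_def = unique_euclidean_semiring_class.cong_def
  \<comment> \<open>the short name \<open>cong_def\<close> denotes a fact of corecursion here\<close>

lemma char_two_power_add:
  fixes x y :: "'a :: comm_ring_1"
  assumes "(2 :: 'a) = 0"
  shows "(x + y) ^ (2 ^ n) = x ^ (2 ^ n) + y ^ (2 ^ n)"
proof (induction n)
  case (Suc n)
  have "(x + y) ^ (2 ^ Suc n) = (x ^ (2 ^ n) + y ^ (2 ^ n))\<^sup>2"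
    by (simp only: power_Suc2 power_mult Suc)
  also have "\<dots> = x ^ (2 ^ Suc n) + y ^ (2 ^ Suc n)"
    by (simp only: power2_sum power_Suc2 power_mult assms) simp
  finally show ?case .
qed simp

lemma char_two_uminus:
  fixes x :: "'a :: comm_ring_1"
  assumes "(2 :: 'a) = 0"
  shows "- x = x"
  by (metis add.right_neutral add_left_cancel add_uminus_conv_diff assms diff_self mult_2 mult_zero_left)

text \<open>Lagrange's root count for residues modulo \<open>g\<close>, stated through divisibility,
  with \<open>S\<close> a set of pairwise incongruent representatives. Splitting off a root
  \<open>a\<close> keeps the leading coefficient, and primality of \<open>g\<close> makes the other
  elements of \<open>S\<close> roots of the quotient.\<close>

lemma card_roots_mod_prime_elem:
  fixes P :: "'a :: idom poly" and g :: 'a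
  assumes g: "prime_elem g" and P: "\<not> g dvd lead_coeff P"
    and S: "finite S" "\<And>a b. a \<in> S \<Longrightarrow> b \<in> S \<Longrightarrow> g dvd a - b \<Longrightarrow> a = b"
    and roots: "\<And>a. a \<in> S \<Longrightarrow> g dvd poly P a"
  shows "card S \<le> degree P"
  using P S roots
proof (induction "degree P" arbitrary: P S)
  case 0
  then obtain c where "P = [:c:]" by (metis degree_eq_zeroE)
  then have "S = {}" using 0 by auto
  then show ?case by simp
next
  case (Suc n)
  show ?case
  proof (cases "S = {}")
    case False
    then obtain a where a: "a \<in> S" by blast
    define Q where "Q = synthetic_div P a"
    have PQ: "P = [:- a, 1:] * Q + [:poly P a:]"
      unfolding Q_def by (rule synthetic_div_correct'[symmetric])
    have dQ: "degree Q = n" using Suc.hyps(2) by (simp add: Q_def degree_synthetic_div)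
    have "coeff P (Suc n) = coeff Q n"
      by (subst PQ) (simp add: dQ coeff_eq_0)
    then have lead: "\<not> g dvd lead_coeff Q" using Suc.prems(1) Suc.hyps(2) dQ by simp
    have "g dvd poly Q b" if b: "b \<in> S - {a}" for b
    proof -
      have "poly P b = (b - a) * poly Q b + poly P a"
        by (subst PQ) (simp add: algebra_simps)
      then have "g dvd (b - a) * poly Q b"
        using Suc.prems(4)[of b] Suc.prems(4)[OF a] b by (simp add: dvd_add_left_iff)
      moreover have "\<not> g dvd b - a" using Suc.prems(3)[of b a] a b by auto
      ultimately show ?thesis using g by (simp add: prime_elem_dvd_mult_iff)
    qed
    then have "card (S - {a}) \<le> degree Q"
      using dQ lead Suc.prems by (intro Suc.hyps(1)) auto
    then show ?thesis using a Suc.prems(2) Suc.hyps(2) dQ by (simp add: card_Diff_singleton)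
  qed simp
qed

section \<open>Additive character sums over a residue field\<close>

text \<open>\<open>K\<close> consists of the canonical remainders and \<open>\<psi>\<close> is a
  nontrivial additive character. Let \<open>q\<close> and \<open>p\<close> be the sizes of
  \<open>K\<close> and \<open>G\<close>. Without a zero-sum triple the cubes of
  \<open>\<eta>\<close> sum to 0 over \<open>K\<close>, so the nonzero \<open>a\<close> must cancel
  the term \<open>p^3\<close>; but they contribute at most \<open>sqrt q * (q * p)\<close>, whence
  \<open>p^4 \<le> q^3\<close>.\<close>

lemma zero_sum_triple_in_residue_field:
  fixes g :: "'a :: unique_euclidean_ring" and K G :: "'a set" and \<psi> :: "'a \<Rightarrow> real"
  assumes two: "(2 :: 'a) = 0" and g: "prime_elem g"
    and K: "K = range (\<lambda>x. x mod g)" "finite K"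
    and \<psi>: "\<And>x. \<psi> x = 1 \<or> \<psi> x = - 1" "\<And>x y. \<psi> (x + y) = \<psi> x * \<psi> y" "\<And>x. \<psi> (x mod g) = \<psi> x"
      "\<psi> y0 = - 1"
    and G: "G \<subseteq> K - {0}" "G \<noteq> {}" "\<And>x y. x \<in> G \<Longrightarrow> y \<in> G \<Longrightarrow> (x * y) mod g \<in> G"
    and large: "card K ^ 3 < card G ^ 4"
  shows "\<exists>x\<in>G. \<exists>y\<in>G. \<exists>z\<in>G. g dvd x + y + z"
proof (rule ccontr)
  assume no: "\<not> ?thesis"
  define q where "q = real (card K)"
  define p where "p = real (card G)"
  define \<eta> where "\<eta> a = (\<Sum>h\<in>G. \<psi> (a * h))" for a
  have fG: "finite G" using G(1) K(2) by (meson finite_Diff finite_subset)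
  have p0: "p > 0" using G fG by (simp add: p_def card_gt_0_iff)
  have Kmod: "x mod g \<in> K" for x using K(1) by blast
  have K0: "0 \<in> K" using Kmod[of 0] by simp
  have q0: "q > 0" using K0 K(2) by (auto simp: q_def card_gt_0_iff)
  have modK: "x mod g = x" if "x \<in> K" for x using that K(1) by auto
  have nd: "\<not> g dvd x" if "x \<in> K - {0}" for x
    using that modK[of x] by (auto simp: dvd_eq_mod_eq_0)
  have inj: "inj_on (\<lambda>a. (a * x) mod g) K" if "\<not> g dvd x" for x
  proof (rule inj_onI)
    fix a b assume ab: "a \<in> K" "b \<in> K" "(a * x) mod g = (b * x) mod g"
    then have "g dvd (a - b) * x" by (simp add: mod_eq_dvd_iff left_diff_distrib)
    then have "g dvd a - b" using that g by (simp add: prime_elem_dvd_mult_iff)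
    then show "a = b" using ab modK by (simp flip: mod_eq_dvd_iff)
  qed
  have \<psi>mod: "\<psi> (a * (x mod g)) = \<psi> (a * x)" "\<psi> ((x mod g) * a) = \<psi> (x * a)" for a x
    by (metis \<psi>(3) mod_mult_right_eq, metis \<psi>(3) mod_mult_left_eq)
  have \<psi>0: "\<psi> 0 = 1"
    using \<psi>(1)[of 0] \<psi>(2)[of 0 0] by auto
  have orth0: "(\<Sum>a\<in>K. \<psi> a) = 0"
  proof -
    \<comment> \<open>Shifting by \<open>y0\<close> negates every term. In characteristic 2 the
      shift is its own inverse, hence the same map in both directions.\<close>
    have "(\<Sum>a\<in>K. \<psi> a) = (\<Sum>a\<in>K. \<psi> (a + y0))"
    proof (rule sum.reindex_bij_witness[where i = "\<lambda>a. (a + y0) mod g" and j = "\<lambda>a. (a + y0) mod g"])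
      fix a assume "a \<in> K"
      then show "((a + y0) mod g + y0) mod g = a"
        using two modK by (simp add: mod_simps add.assoc)
      then show "((a + y0) mod g + y0) mod g = a" .
      show "\<psi> ((a + y0) mod g + y0) = \<psi> a"
        using \<open>((a + y0) mod g + y0) mod g = a\<close> by (metis \<psi>(3))
    qed (rule Kmod)+
    also have "\<dots> = - (\<Sum>a\<in>K. \<psi> a)"
      using \<psi> by (simp add: sum_negf)
    finally show ?thesis by simp
  qed
  have orth: "(\<Sum>a\<in>K. \<psi> (a * x)) = (if g dvd x then q else 0)" for x
  proof (cases "g dvd x")
    case True
    then have "\<psi> (a * x) = 1" for a using \<psi>(3)[of "a * x"] \<psi>0 by (simp add: dvd_imp_mod_0)
    then show ?thesis using True by (simp add: q_def)
  next
    case False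
    have "bij_betw (\<lambda>a. (a * x) mod g) K K"
      by (intro bij_betw_imageI inj[OF False] endo_inj_surj K(2) image_subsetI Kmod)
    then have "(\<Sum>a\<in>K. \<psi> ((a * x) mod g)) = (\<Sum>a\<in>K. \<psi> a)"
      by (rule sum.reindex_bij_betw)
    then show ?thesis using orth0 False \<psi>(3) by simp
  qed
  have \<eta>2: "(\<eta> a)\<^sup>2 = (\<Sum>h\<in>G. \<Sum>k\<in>G. \<psi> (a * (h + k)))" for a
    unfolding \<eta>_def power2_eq_square sum_product by (simp only: distrib_left \<psi>(2))
  have \<eta>3: "(\<eta> a)^3 = (\<Sum>h\<in>G. \<Sum>k\<in>G. \<Sum>l\<in>G. \<psi> (a * (h + k + l)))" for a
  proof -
    have "(\<eta> a)^3 = (\<eta> a)\<^sup>2 * \<eta> a" by (simp add: power2_eq_square power3_eq_cube)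
    also have "\<dots> = (\<Sum>h\<in>G. \<Sum>k\<in>G. \<Sum>l\<in>G. \<psi> (a * (h + k)) * \<psi> (a * l))"
      unfolding \<eta>2 sum_distrib_right unfolding \<eta>_def sum_distrib_left by (rule refl)
    also have "\<dots> = (\<Sum>h\<in>G. \<Sum>k\<in>G. \<Sum>l\<in>G. \<psi> (a * (h + k + l)))"
      by (simp only: distrib_left \<psi>(2))
    finally show ?thesis .
  qed
  \<comment> \<open>Parseval: by orthogonality only pairs with \<open>g dvd h + k\<close> survive,
    and in characteristic 2 these are the diagonal ones.\<close>
  have S2: "(\<Sum>a\<in>K. (\<eta> a)\<^sup>2) = q * p"
  proof -
    have "(\<Sum>a\<in>K. (\<eta> a)\<^sup>2) = (\<Sum>h\<in>G. \<Sum>a\<in>K. \<Sum>k\<in>G. \<psi> (a * (h + k)))"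
      unfolding \<eta>2 by (rule sum.swap)
    also have "\<dots> = (\<Sum>h\<in>G. \<Sum>k\<in>G. \<Sum>a\<in>K. \<psi> (a * (h + k)))"
      by (rule sum.cong[OF refl], rule sum.swap)
    also have "\<dots> = (\<Sum>h\<in>G. \<Sum>k\<in>G. if k = h then q else 0)"
    proof (intro sum.cong refl)
      fix h k assume "h \<in> G" "k \<in> G"
      then have "h mod g = h" "k mod g = k" using G(1) modK by auto
      moreover have "h + k = k - h" using char_two_uminus[OF two, of h] by (metis add.commute diff_conv_add_uminus)
      ultimately have "g dvd h + k \<longleftrightarrow> k = h" by (metis mod_eq_dvd_iff)
      then show "(\<Sum>a\<in>K. \<psi> (a * (h + k))) = (if k = h then q else 0)"
        by (simp add: orth)
    qed
    also have "\<dots> = q * p" using fG by (simp add: p_def)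
    finally show ?thesis .
  qed
  have S3: "(\<Sum>a\<in>K. (\<eta> a)^3) = 0"
  proof -
    have "(\<Sum>a\<in>K. (\<eta> a)^3) = (\<Sum>h\<in>G. \<Sum>a\<in>K. \<Sum>k\<in>G. \<Sum>l\<in>G. \<psi> (a * (h + k + l)))"
      unfolding \<eta>3 by (rule sum.swap)
    also have "\<dots> = (\<Sum>h\<in>G. \<Sum>k\<in>G. \<Sum>a\<in>K. \<Sum>l\<in>G. \<psi> (a * (h + k + l)))"
      by (rule sum.cong[OF refl], rule sum.swap)
    also have "\<dots> = (\<Sum>h\<in>G. \<Sum>k\<in>G. \<Sum>l\<in>G. \<Sum>a\<in>K. \<psi> (a * (h + k + l)))"
      by (rule sum.cong[OF refl], rule sum.cong[OF refl], rule sum.swap)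
    also have "\<dots> = (\<Sum>h\<in>G. \<Sum>k\<in>G. \<Sum>l\<in>G. 0)"
      using no by (intro sum.cong refl) (simp add: orth)
    finally show ?thesis by simp
  qed
  have \<eta>0: "\<eta> 0 = p" by (simp add: \<eta>_def \<psi>0 p_def)
  have T2: "(\<Sum>a\<in>K - {0}. (\<eta> a)\<^sup>2) = q * p - p\<^sup>2"
    using S2 K(2) K0 by (simp add: sum_diff1 \<eta>0)
  have T3: "(\<Sum>a\<in>K - {0}. (\<eta> a)^3) = - (p^3)"
    using S3 K(2) K0 by (simp add: sum_diff1 \<eta>0)
  have inv: "\<eta> ((a * k) mod g) = \<eta> a" if k: "k \<in> G" for a k
  proof -
    have "inj_on (\<lambda>h. (h * k) mod g) G"
      using inj_on_subset[OF inj[of k], of G] nd[of k] k G(1) by auto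
    then have "bij_betw (\<lambda>h. (h * k) mod g) G G"
      by (intro bij_betw_imageI endo_inj_surj fG image_subsetI G(3) k)
    then have "(\<Sum>h\<in>G. \<psi> (a * ((h * k) mod g))) = \<eta> a"
      unfolding \<eta>_def by (rule sum.reindex_bij_betw)
    then show ?thesis unfolding \<eta>_def \<psi>mod by (simp only: mult_ac)
  qed
  \<comment> \<open>The products \<open>a * k\<close> with \<open>k\<close> in \<open>G\<close> are
    distinct nonzero residues sharing the value of \<open>\<eta>\<close>, so
    \<open>p * (\<eta> a)\<^sup>2\<close> is at most the whole sum \<open>T2\<close>.\<close>
  have bound: "\<bar>\<eta> a\<bar> \<le> sqrt q" if a: "a \<in> K - {0}" for a
  proof -
    have inja: "inj_on (\<lambda>k. (a * k) mod g) G"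
      using inj_on_subset[OF inj[OF nd[OF a]], of G] G(1) by (auto simp: mult.commute)
    have "(a * k) mod g \<in> K - {0}" if "k \<in> G" for k
    proof -
      have "\<not> g dvd a * k" using nd[OF a] nd[of k] that G(1) g by (auto simp: prime_elem_dvd_mult_iff)
      then show ?thesis using Kmod by (simp add: dvd_eq_mod_eq_0)
    qed
    then have sub: "(\<lambda>k. (a * k) mod g) ` G \<subseteq> K - {0}"
      by (intro image_subsetI)
    have "p * (\<eta> a)\<^sup>2 = (\<Sum>k\<in>G. (\<eta> ((a * k) mod g))\<^sup>2)"
      using inv by (simp add: p_def)
    also have "\<dots> = (\<Sum>b\<in>(\<lambda>k. (a * k) mod g) ` G. (\<eta> b)\<^sup>2)"
      using inja by (simp add: sum.reindex)
    also have "\<dots> \<le> (\<Sum>b\<in>K - {0}. (\<eta> b)\<^sup>2)"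
      using sub K(2) by (intro sum_mono2) auto
    also have "\<dots> \<le> q * p" using T2 by simp
    finally have "(\<eta> a)\<^sup>2 \<le> q" using p0 by (simp add: mult.commute)
    then show ?thesis by (simp add: real_le_rsqrt)
  qed
  have "p^3 = \<bar>\<Sum>a\<in>K - {0}. (\<eta> a)^3\<bar>" using T3 p0 by simp
  also have "\<dots> \<le> (\<Sum>a\<in>K - {0}. \<bar>(\<eta> a)^3\<bar>)" by (rule sum_abs)
  \<comment> \<open>One factor of the cube is bounded pointwise, the other two are summed by
    Parseval.\<close>
  also have "\<dots> \<le> (\<Sum>a\<in>K - {0}. sqrt q * (\<eta> a)\<^sup>2)"
  proof (intro sum_mono)
    fix a assume "a \<in> K - {0}"
    then have "\<bar>\<eta> a\<bar> * (\<eta> a)\<^sup>2 \<le> sqrt q * (\<eta> a)\<^sup>2"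
      using bound by (intro mult_right_mono) auto
    then show "\<bar>(\<eta> a)^3\<bar> \<le> sqrt q * (\<eta> a)\<^sup>2"
      by (simp add: power3_eq_cube power2_eq_square abs_mult)
  qed
  also have "\<dots> = sqrt q * (q * p - p\<^sup>2)" by (simp add: T2 flip: sum_distrib_left)
  also have "\<dots> \<le> sqrt q * (q * p)" using q0 by (intro mult_left_mono) auto
  finally have "p * p\<^sup>2 \<le> p * (sqrt q * q)"
    by (simp add: power3_eq_cube power2_eq_square mult_ac)
  then have "p\<^sup>2 \<le> sqrt q * q" using p0 by simp
  then have "(p\<^sup>2)\<^sup>2 \<le> (sqrt q * q)\<^sup>2" by (intro power_mono) auto
  also have "\<dots> = q ^ 3" using q0 by (simp add: power_mult_distrib power2_eq_square power3_eq_cube)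
  finally have "p ^ 4 \<le> q ^ 3" by simp
  then have "card G ^ 4 \<le> card K ^ 3"
    unfolding p_def q_def by (metis of_nat_le_iff of_nat_power)
  with large show False by simp
qed

section \<open>Binary polynomials and the parity function\<close>

text \<open>A divisor of least positive degree is irreducible: a nonconstant factor of it already
  has full degree, so the cofactor is constant.\<close>

lemma exists_prime_elem_dvd:
  fixes Q :: "'a :: field poly"
  assumes "degree Q > 0"
  obtains g where "prime_elem g" "g dvd Q" "degree g > 0"
proof -
  define g where "g = (ARG_MIN degree g. g dvd Q \<and> degree g > 0)"
  have g: "g dvd Q \<and> degree g > 0"
    unfolding g_def by (rule arg_min_natI[of _ Q]) (use assms in auto)
  have min: "degree g \<le> degree h" if "h dvd Q" "degree h > 0" for h
    unfolding g_def by (rule arg_min_nat_le) (use that in auto)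
  have "irreducible g"
  proof (rule irreducibleI)
    show "g \<noteq> 0" using g by auto
    then show "\<not> g dvd 1" using g by (simp add: is_unit_iff_degree)
    fix a b assume ab: "g = a * b"
    then have nz: "a \<noteq> 0" "b \<noteq> 0" using g by auto
    have "degree g = degree a + degree b" using nz unfolding ab by (rule degree_mult_eq)
    moreover have "a dvd Q" using g ab by (metis dvd_mult_left)
    then have "degree a > 0 \<Longrightarrow> degree g \<le> degree a" by (rule min)
    ultimately have "degree a = 0 \<or> degree b = 0" by linarith
    then show "a dvd 1 \<or> b dvd 1" using nz by (simp add: is_unit_iff_degree)
  qed
  then show ?thesis using g that field_poly_irreducible_imp_prime by blast
qed

text \<open>Squaring is additive and fixes both coefficients 0 and 1, so it acts on the variable
  only.\<close>

lemma power_two_power_bit_poly: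
  fixes h :: "bit poly"
  shows "h ^ (2 ^ n) = pcompose h (monom 1 (2 ^ n))"
proof (induction h)
  case (pCons a h)
  have two: "(2 :: bit poly) = 0" by (simp add: numeral_poly)
  have a: "a ^ (2 ^ n) = a" by (cases a) (simp_all add: power_0_left)
  have "pCons a h = [:a:] + monom 1 1 * h" by (simp add: monom_altdef)
  then have "(pCons a h) ^ (2 ^ n) = [:a:] ^ (2 ^ n) + (monom 1 1) ^ (2 ^ n) * h ^ (2 ^ n)"
    by (simp only: char_two_power_add[OF two] power_mult_distrib)
  also have "[:a:] ^ (2 ^ n) = [:a:]" by (simp only: poly_const_pow a)
  also have "monom (1 :: bit) 1 ^ (2 ^ n) = monom 1 (2 ^ n)" by (simp add: monom_power)
  finally show ?case using pCons.IH by (simp add: pcompose_pCons)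
qed (simp add: power_0_left)

text \<open>A relation \<open>X^s\<^sub>0 + X^s\<^sub>1 + X^s\<^sub>2 = 0\<close> modulo
  \<open>g\<close> survives raising to the power \<open>2^k\<close> and multiplication by
  \<open>X^a\<close>. Taking constant coefficients of remainders, an additive map, turns it into the
  parity condition.\<close>

lemma exists_parity_function:
  fixes p t :: nat
  assumes p: "prime p" "p dvd 2 ^ t - 1" and t: "t > 0" and large: "(2 ^ t) ^ 3 < p ^ 4"
  shows "\<exists>(f :: nat \<Rightarrow> bool) (s :: nat \<Rightarrow> nat). f 0 \<and>
    (\<forall>m n. [m = n] (mod p) \<longrightarrow> f m = f n) \<and>
    (\<forall>a k. even (\<Sum>l<3. of_bool (f (a + 2 ^ k * s l)) :: nat))"
proof -
  have two: "(2 :: bit poly) = 0" by (simp add: numeral_poly)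
  have "odd p"
  proof
    assume "even p"
    then have "even (2 ^ t - 1 :: nat)" using p dvd_trans by blast
    with t show False by simp
  qed
  then obtain m where m: "p = 2 * m + 1" by (elim oddE)
  have m0: "m > 0" using m prime_gt_1_nat[OF p(1)] by simp
  define X where "X = (monom 1 1 :: bit poly)"
  define Q where "Q = (\<Sum>i<p. X ^ i)"
  have "X ^ p - 1 = (X - 1) * Q" unfolding Q_def by (rule power_diff_1_eq)
  have "coeff Q (p - 1) = (\<Sum>i<p. if i = p - 1 then 1 else 0)"
    unfolding Q_def X_def coeff_sum by (intro sum.cong) (auto simp: monom_power)
  then have "coeff Q (p - 1) \<noteq> 0" using m by simp
  then have "degree Q > 0" using m m0 le_degree[of Q "p - 1"] by simp
  then obtain g where g: "prime_elem g" "g dvd Q" "degree g > 0" by (rule exists_prime_elem_dvd)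
  have g1: "\<not> g dvd 1" using g by (auto simp: is_unit_iff_degree)
  have "g dvd X ^ p - 1" using g(2) \<open>X ^ p - 1 = (X - 1) * Q\<close> by simp
  then have Xp: "[X ^ p = 1] (mod g)" by (simp only: cong_iff_dvd_diff)
  have Xmod: "X ^ i mod g = X ^ (i mod p) mod g" for i
  proof -
    have "[(X ^ p) ^ (i div p) * X ^ (i mod p) = 1 ^ (i div p) * X ^ (i mod p)] (mod g)"
      by (intro cong_mult cong_pow cong_refl Xp)
    then show ?thesis by (simp add: cong_mod_def flip: power_mult power_add)
  qed
  have X0: "\<not> g dvd X ^ i" for i
  proof
    assume "g dvd X ^ i"
    then have "g dvd X" using g(1) prime_elem_dvd_power by blast
    then have "g dvd X ^ p" using m by simp
    then show False using Xp g1 by (simp add: cong_dvd_iff)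
  qed
  \<comment> \<open>If \<open>X\<close> were 1 modulo \<open>g\<close>, then \<open>Q\<close> would
    be a sum of \<open>p\<close> ones, which is 1 since \<open>p\<close> is odd, although
    \<open>g\<close> divides \<open>Q\<close>.\<close>
  have X1: "\<not> g dvd X - 1"
  proof
    assume "g dvd X - 1"
    then have "[X = 1] (mod g)" by (simp only: cong_iff_dvd_diff)
    then have "[Q = (\<Sum>i<p. 1 ^ i)] (mod g)" unfolding Q_def by (intro cong_sum cong_pow)
    moreover have "(\<Sum>i<p. 1 ^ i :: bit poly) = 1" by (simp add: m two)
    ultimately show False using g(2) g1 by (simp add: cong_dvd_iff)
  qed
  define K where "K = range (\<lambda>h. h mod g)"
  \<comment> \<open>It suffices that \<open>X\<close> itself is fixed, which follows from
    \<open>2^t\<close> being 1 modulo \<open>p\<close>.\<close>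
  have frob: "[h ^ (2 ^ t) = h] (mod g)" for h
  proof -
    obtain c where c: "2 ^ t - 1 = p * c" using p(2) by blast
    then have "2 ^ t = p * c + 1" by (metis Suc_eq_plus1 Suc_pred' pos2 zero_less_power)
    then have "2 ^ t mod p = 1 mod p" by (simp only: mod_mult_self4)
    then have "X ^ (2 ^ t) mod g = X ^ 1 mod g"
      using Xmod[of "2 ^ t"] Xmod[of 1] by (simp only:)
    then have Xt: "[monom 1 (2 ^ t) = monom 1 1] (mod g)"
      by (simp add: X_def monom_power cong_mod_def)
    have "[pcompose h (monom 1 (2 ^ t)) = h] (mod g)"
    proof (induction h)
      case (pCons a h)
      have "[[:a:] + monom 1 (2 ^ t) * pcompose h (monom 1 (2 ^ t)) = [:a:] + monom 1 1 * h] (mod g)"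
        by (intro cong_add cong_mult cong_refl Xt pCons.IH)
      moreover have "[:a:] + monom 1 1 * h = pCons a h" by (simp add: monom_altdef)
      ultimately show ?case by (simp only: pcompose_pCons)
    qed simp
    then show ?thesis by (simp only: power_two_power_bit_poly)
  qed
  \<comment> \<open>A uniform bound on finite subsets yields finiteness of \<open>K\<close> along
    with its size.\<close>
  have "card S \<le> 2 ^ t" if S: "S \<subseteq> K" "finite S" for S
  proof -
    have one_less: "(1 :: nat) < 2 ^ t" using one_less_power[of "2 :: nat" t] t by simp
    define P where "P = (monom 1 (2 ^ t) - monom 1 1 :: bit poly poly)"
    have d: "degree P = 2 ^ t" unfolding P_def
      using one_less by (simp add: diff_conv_add_uminus degree_add_eq_left degree_monom_eq
          del: add_uminus_conv_diff)
    have "lead_coeff P = 1" unfolding d using one_less by (simp add: P_def)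
    then have "card S \<le> degree P"
    proof (intro card_roots_mod_prime_elem[OF g(1)])
      fix a b assume ab: "a \<in> S" "b \<in> S" "g dvd a - b"
      then have "a mod g = b mod g" by (simp only: mod_eq_dvd_iff)
      moreover have "a mod g = a" "b mod g = b" using ab S(1) by (auto simp: K_def)
      ultimately show "a = b" by simp
    next
      fix a show "g dvd poly P a"
        using frob[of a] by (simp add: P_def poly_monom cong_iff_dvd_diff)
    qed (use g1 S in simp_all)
    then show ?thesis by (simp add: d)
  qed
  then have "finite K \<and> card K \<le> 2 ^ t" by (intro finite_if_finite_subsets_card_bdd) auto
  then have fK: "finite K" and cK: "card K \<le> 2 ^ t" by auto
  \<comment> \<open>As \<open>p\<close> is prime, \<open>j - i\<close> is invertible modulo
    \<open>p\<close>, so \<open>X^(j - i) = 1\<close> would give \<open>X = 1\<close>, against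
    \<open>X1\<close>.\<close>
  have inj: "inj_on (\<lambda>i. X ^ i mod g) {..<p}"
  proof (rule linorder_inj_onI)
    fix i j assume ij: "i < j" "i \<in> {..<p}" "j \<in> {..<p}"
    show "X ^ i mod g \<noteq> X ^ j mod g"
    proof
      assume eq: "X ^ i mod g = X ^ j mod g"
      have "X ^ j - X ^ i = X ^ i * (X ^ (j - i) - 1)"
        using ij by (simp add: right_diff_distrib flip: power_add)
      then have "g dvd X ^ i * (X ^ (j - i) - 1)" using eq by (metis mod_eq_dvd_iff)
      then have "g dvd X ^ (j - i) - 1" using g(1) X0 by (simp add: prime_elem_dvd_mult_iff)
      then have 1: "X ^ (j - i) mod g = 1 mod g" by (simp add: mod_eq_dvd_iff)
      have "\<not> p dvd j - i" using ij by (auto dest: dvd_imp_le)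
      then have "coprime (j - i) p" using p(1) prime_imp_coprime[of p "j - i"]
        by (simp add: coprime_commute)
      then obtain u where "[(j - i) * u = 1] (mod p)" using cong_solve_coprime_nat by auto
      then have "X ^ 1 mod g = X ^ ((j - i) * u) mod g"
        using Xmod[of "(j - i) * u"] Xmod[of 1] by (simp only: cong_mod_def)
      also have "\<dots> = 1 mod g"
        using cong_pow[of "X ^ (j - i)" 1 g u] 1 by (simp add: cong_mod_def power_mult)
      finally show False using X1 by (simp add: mod_eq_dvd_iff)
    qed
  qed auto
  define G where "G = (\<lambda>i. X ^ i mod g) ` {..<p}"
  have cG: "card G = p" unfolding G_def using inj by (simp add: card_image)
  have GX: "X ^ i mod g \<in> G" for i
    using Xmod[of i] m by (simp add: G_def)
  define \<phi> where "\<phi> h = coeff (h mod g) 0" for h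
  have \<phi>add: "\<phi> (h + k) = \<phi> h + \<phi> k" for h k by (simp add: \<phi>_def poly_mod_add_left)
  have \<phi>1: "\<phi> 1 = 1" using g(3) by (simp add: \<phi>_def mod_poly_less)
  define \<psi> :: "bit poly \<Rightarrow> real" where "\<psi> h = (if \<phi> h = 0 then 1 else - 1)" for h
  have "\<exists>x\<in>G. \<exists>y\<in>G. \<exists>z\<in>G. g dvd x + y + z"
  proof (rule zero_sum_triple_in_residue_field[OF two g(1) K_def fK, where \<psi> = \<psi>])
    show "\<psi> (h + k) = \<psi> h * \<psi> k" for h k
      by (cases "\<phi> h"; cases "\<phi> k") (simp_all add: \<psi>_def \<phi>add)
    show "\<psi> 1 = - 1" by (simp add: \<psi>_def \<phi>1)
    show "(x * y) mod g \<in> G" if xy: "x \<in> G" "y \<in> G" for x y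
    proof -
      obtain i j where "x = X ^ i mod g" "y = X ^ j mod g" using xy by (auto simp: G_def)
      then have "(x * y) mod g = X ^ (i + j) mod g" by (simp add: mod_simps power_add)
      then show ?thesis using GX by simp
    qed
    have "X ^ i mod g \<in> K - {0}" for i using X0[of i] by (simp add: K_def dvd_eq_mod_eq_0)
    then show "G \<subseteq> K - {0}" unfolding G_def by (intro image_subsetI)
    show "G \<noteq> {}" using GX by blast
    have "card K ^ 3 \<le> (2 ^ t) ^ 3" using cK by (intro power_mono) auto
    also note large
    finally show "card K ^ 3 < card G ^ 4" by (simp only: cG)
  qed (simp_all add: \<psi>_def \<phi>_def)
  then obtain sx sy sz where "g dvd X ^ sx mod g + X ^ sy mod g + X ^ sz mod g"
    by (auto simp: G_def)
  moreover have "[X ^ i mod g = X ^ i] (mod g)" for i by (simp add: cong_mod_def)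
  then have "[X ^ sx mod g + X ^ sy mod g + X ^ sz mod g = X ^ sx + X ^ sy + X ^ sz] (mod g)"
    by (intro cong_add)
  ultimately have zero: "g dvd X ^ sx + X ^ sy + X ^ sz" by (simp only: cong_dvd_iff)
  define f where "f i \<longleftrightarrow> \<phi> (X ^ i) = 1" for i
  define s where "s l = (if l = 0 then sx else if l = 1 then sy else sz)" for l :: nat
  have "f 0" by (simp add: f_def \<phi>1)
  moreover have "f i = f j" if "[i = j] (mod p)" for i j
    using that Xmod[of i] Xmod[of j] by (simp add: f_def \<phi>_def cong_mod_def)
  moreover have "even (\<Sum>l<3. of_bool (f (b + 2 ^ k * s l)) :: nat)" for b k
  proof -
    define T where "T r = \<phi> (X ^ (b + 2 ^ k * r))" for r
    have eq: "X ^ (b + 2 ^ k * r) = X ^ b * (X ^ r) ^ (2 ^ k)" for r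
      by (simp add: power_add mult.commute flip: power_mult)
    have "T sx + T sy + T sz = \<phi> (X ^ b * (X ^ sx + X ^ sy + X ^ sz) ^ (2 ^ k))"
      unfolding T_def eq by (simp only: \<phi>add distrib_left char_two_power_add[OF two])
    also have "\<dots> = 0"
    proof -
      have "g dvd (X ^ sx + X ^ sy + X ^ sz) ^ (2 ^ k)"
        by (rule dvd_trans[OF zero]) (simp add: dvd_power)
      then show ?thesis by (simp add: \<phi>_def dvd_imp_mod_0)
    qed
    finally have "T sx + T sy + T sz = 0" .
    moreover have "(\<Sum>l<3. of_bool (f (b + 2 ^ k * s l)) :: nat)
      = of_bool (T sx = 1) + of_bool (T sy = 1) + of_bool (T sz = 1)"
      by (simp add: f_def T_def s_def eval_nat_numeral)
    ultimately show ?thesis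
      by (cases "T sx"; cases "T sy"; cases "T sz") simp_all
  qed
  ultimately show ?thesis by blast
qed

section \<open>Powers of 2 modulo \<open>p\<close>\<close>

text \<open>The units modulo \<open>p\<close> form a cyclic group, which has only one subgroup of
  order \<open>ord p b\<close>. Both the \<open>e\<close>-th powers and the powers of
  \<open>b\<close> are such a subgroup.\<close>

lemma power_cong_power_of_base:
  fixes p b e x :: nat
  assumes p: "prime p" and b: "coprime p b" and e: "e * ord p b = p - 1" and x: "\<not> p dvd x"
  shows "\<exists>k. [x ^ e = b ^ k] (mod p)"
proof -
  have p1: "p > 1" using p prime_gt_1_nat by blast
  obtain g where g: "residue_primroot p g" using prime_primitive_root_exists[OF p1 p] by blast
  have tot: "totient p = p - 1" using p by (rule totient_prime)
  have ordg: "ord p g = p - 1" using g tot by (simp add: residue_primroot_def)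
  have gen: "\<exists>l. [y = g ^ l] (mod p)" if "\<not> p dvd y" for y
  proof -
    have "y mod p \<in> totatives p"
      using p1 that by (simp add: totatives_prime[OF p] mod_greater_zero_iff_not_dvd)
    then have "y mod p \<in> (\<lambda>i. g ^ i mod p) ` {..<totient p}"
      using residue_primroot_is_generator[OF p1 g] by (simp add: bij_betw_def)
    then obtain l where "y mod p = g ^ l mod p" by blast
    then show ?thesis by (auto simp: cong_mod_def)
  qed
  have "\<not> p dvd b" using b p1 coprime_absorb_left[of p b] by auto
  then obtain k where k: "[b = g ^ k] (mod p)" using gen by blast
  have "[g ^ (k * ord p b) = 1] (mod p)"
    using cong_pow[OF k, of "ord p b"] ord[of b p] by (metis cong_sym cong_trans power_mult)
  then have "e * ord p b dvd k * ord p b" by (simp only: ord_divides ordg e)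
  moreover have s0: "ord p b > 0" using b by simp
  ultimately obtain k' where k': "k = e * k'" by auto
  have cyc: "[g ^ (e * l) = g ^ (e * (l mod ord p b))] (mod p)" for l
  proof -
    have "e * l = (p - 1) * (l div ord p b) + e * (l mod ord p b)"
      by (metis add_mult_distrib2 div_mult_mod_eq e mult.assoc mult.commute)
    then have "g ^ (e * l) = (g ^ (p - 1)) ^ (l div ord p b) * g ^ (e * (l mod ord p b))"
      by (simp add: power_add power_mult)
    moreover have "[(g ^ (p - 1)) ^ (l div ord p b) = 1 ^ (l div ord p b)] (mod p)"
      using ord[of g p] ordg by (intro cong_pow) simp
    ultimately show ?thesis by (metis cong_scalar_right mult_1 power_one)
  qed
  define A where "A = (\<lambda>u. b ^ u mod p) ` {..<ord p b}"
  define B where "B = (\<lambda>l. g ^ (e * l) mod p) ` {..<ord p b}"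
  \<comment> \<open>\<open>A\<close> lies in \<open>B\<close> because \<open>k\<close> is a multiple
    of \<open>e\<close>; equality follows by counting, as \<open>B\<close> has at most
    \<open>ord p b\<close> elements.\<close>
  have "A = B"
  proof (rule card_seteq)
    show "finite B" by (simp add: B_def)
    show "A \<subseteq> B"
    proof
      fix y assume "y \<in> A"
      then obtain u where "y = b ^ u mod p" by (auto simp: A_def)
      also have "\<dots> = g ^ (e * (k' * u)) mod p"
        using cong_pow[OF k, of u] by (simp add: cong_mod_def k' mult.assoc flip: power_mult)
      also have "\<dots> = g ^ (e * ((k' * u) mod ord p b)) mod p"
        using cyc by (simp add: cong_mod_def)
      finally show "y \<in> B" using s0 by (simp add: B_def)
    qed
    have "card A = ord p b"
      unfolding A_def using inj_power_mod[OF b] by (simp add: card_image)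
    then show "card B \<le> card A" unfolding B_def by (metis card_image_le card_lessThan finite_lessThan)
  qed
  obtain l where l: "[x = g ^ l] (mod p)" using gen x by blast
  have "x ^ e mod p = g ^ (e * l) mod p"
    using cong_pow[OF l, of e] by (simp add: cong_mod_def mult.commute flip: power_mult)
  also have "\<dots> = g ^ (e * (l mod ord p b)) mod p" using cyc by (simp add: cong_mod_def)
  also have "\<dots> \<in> A" using s0 unfolding \<open>A = B\<close> by (simp add: B_def)
  finally show ?thesis by (auto simp: A_def cong_mod_def)
qed

text \<open>An order \<open>s\<close> properly dividing \<open>t\<close> is at most
  \<open>t / 2\<close>, and then \<open>p \<le> 2^s\<close> is too small.\<close>

lemma ord_two_of_large_mersenne_divisor:
  fixes p t :: nat
  assumes p: "p dvd 2 ^ t - 1" and t: "t > 0" and large: "(2 ^ t) ^ 3 < p ^ 4"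
  shows "ord p 2 = t"
proof (rule ccontr)
  assume ne: "ord p 2 \<noteq> t"
  have "[2 ^ t = 1] (mod p)" using p by (metis cong_altdef_nat cong_sym one_le_numeral one_le_power)
  then have "ord p 2 dvd t" by (simp only: ord_divides)
  then obtain m where m: "t = ord p 2 * m" by blast
  define s where "s = ord p 2"
  have "s > 0" using m t by (auto simp: s_def)
  have "m \<noteq> 0" "m \<noteq> 1" using m t ne by auto
  then have "s * 2 \<le> t" unfolding m s_def by (intro mult_le_mono2) simp
  have "[2 ^ s = 1] (mod p)" unfolding s_def by (rule ord)
  then have "p dvd 2 ^ s - 1" by (metis cong_altdef_nat one_le_numeral one_le_power)
  then have "p \<le> 2 ^ s - 1" using one_less_power[of "2 :: nat" s] \<open>s > 0\<close> by (intro dvd_imp_le) auto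
  then have "p \<le> 2 ^ s" by simp
  then have "p ^ 4 \<le> (2 ^ s) ^ 4" by (rule power_mono) simp
  also have "\<dots> = 2 ^ (s * 2 * 2)" by (simp flip: power_mult)
  also have "\<dots> \<le> 2 ^ (t * 3)" using \<open>s * 2 \<le> t\<close> by (intro power_increasing) auto
  also have "\<dots> = (2 ^ t) ^ 3" by (simp add: power_mult)
  finally show False using large by simp
qed

section \<open>Decoding with three queries\<close>

text \<open>Codeword positions are the elements of \<open>W\<close>, and \<open>F j\<close> is the
  contribution of message bit \<open>j\<close>. For \<open>w\<close> uniform in \<open>R i\<close>
  each query is uniform on a set of at least \<open>card W / p\<close> positions, so it hits a
  corrupted one with probability at most 1/12; three queries fail with probability at most
  1/4.\<close>

lemma locally_decodable_of_smooth_parity_checks: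
  fixes W :: "'w set" and F :: "nat \<Rightarrow> 'w \<Rightarrow> bool" and Q :: "nat \<Rightarrow> nat \<Rightarrow> 'w \<Rightarrow> 'w"
    and R :: "nat \<Rightarrow> 'w set" and p n :: nat
  assumes W: "finite W" "W \<noteq> {}" and p: "p > 0"
    and R: "\<And>i. i < n \<Longrightarrow> R i \<subseteq> W" "\<And>i. i < n \<Longrightarrow> card W \<le> p * card (R i)"
    and Q: "\<And>i l. i < n \<Longrightarrow> l < 3 \<Longrightarrow> inj_on (Q i l) (R i)"
      "\<And>i l w. i < n \<Longrightarrow> l < 3 \<Longrightarrow> w \<in> R i \<Longrightarrow> Q i l w \<in> W"
    and F: "\<And>i j w. i < n \<Longrightarrow> j < n \<Longrightarrow> w \<in> R i \<Longrightarrow>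
      odd (\<Sum>l<3. of_bool (F j (Q i l w)) :: nat) \<longleftrightarrow> i = j"
  shows "\<exists>C. C \<in> bitstrings n \<rightarrow> bitstrings (card W) \<and>
    locally_decodable n (card W) C 3 (1 / (12 * real p)) (1 / 4)"
proof -
  define N where "N = card W"
  obtain g where g: "bij_betw g {0..<N} W"
    using ex_bij_betw_nat_finite[OF W(1)] by (auto simp: N_def)
  define h where "h = inv_into {0..<N} g"
  have h: "h w < N" "g (h w) = w" if "w \<in> W" for w
  proof -
    have "w \<in> g ` {0..<N}" using g that by (simp add: bij_betw_def)
    then show "h w < N" "g (h w) = w"
      unfolding h_def using inv_into_into[of w g "{0..<N}"] f_inv_into_f[of w g "{0..<N}"] by auto
  qed
  define C where "C x = map (\<lambda>s. odd (\<Sum>j<n. of_bool (x ! j \<and> F j (g s)) :: nat)) [0..<N]" for x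
  \<comment> \<open>The nested inequality is the exclusive or of the three answers; the queried
    positions do not depend on the answers.\<close>
  define D where "D i w = Query (h (Q i 0 w)) (\<lambda>a. Query (h (Q i 1 w)) (\<lambda>b.
    Query (h (Q i 2 w)) (\<lambda>c. Output (a \<noteq> (b \<noteq> c)))))" for i w
  define A where "A i = map_pmf (D i) (pmf_of_set (R i))" for i
  have fR: "finite (R i)" "R i \<noteq> {}" if "i < n" for i
  proof -
    show "finite (R i)" using R(1)[OF that] W(1) finite_subset by blast
    have "card W > 0" using W by (simp add: card_gt_0_iff)
    then show "R i \<noteq> {}" using R(2)[OF that] by auto
  qed
  have hQ: "h (Q i l w) < N" "g (h (Q i l w)) = Q i l w" if "i < n" "l < 3" "w \<in> R i" for i l w
    using h[OF Q(2)[OF that]] by auto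
  have "length (queries T y) \<le> 3 \<and> set (queries T y) \<subseteq> {..<N}"
    if i: "i < n" and T: "T \<in> set_pmf (A i)" for i T y
  proof -
    obtain w where "w \<in> R i" "T = D i w"
      using T fR[OF i] by (auto simp: A_def)
    then show ?thesis using hQ[OF i, of 0] hQ[OF i, of 1] hQ[OF i, of 2] by (auto simp: D_def)
  qed
  moreover have "measure_pmf.prob (A i) {T. run T y = x ! i} \<ge> 1 - 1 / 4"
    if i: "i < n" and d: "real (hamming_dist (C x) y) \<le> 1 / (12 * real p) * real N" for x i y
  proof -
    define H where "H = {j. j < N \<and> C x ! j \<noteq> y ! j}"
    \<comment> \<open>The coin tosses for which query \<open>l\<close> meets a corrupted
      position.\<close>
    define E where "E l = {w \<in> R i. h (Q i l w) \<in> H}" for l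
    have cH: "card H = hamming_dist (C x) y" by (simp add: H_def hamming_dist_def C_def)
    have fH: "finite H" by (simp add: H_def)
    have cE: "card (E l) \<le> card H" if l: "l < 3" for l
    proof (rule card_inj_on_le)
      show "inj_on (\<lambda>w. h (Q i l w)) (E l)"
      proof (rule inj_onI)
        fix w w' assume w: "w \<in> E l" "w' \<in> E l" "h (Q i l w) = h (Q i l w')"
        then have "Q i l w = Q i l w'" using hQ(2)[OF i l] by (metis (no_types, lifting) E_def mem_Collect_eq)
        then show "w = w'" using Q(1)[OF i l] w by (auto simp: E_def inj_on_def)
      qed
    qed (auto simp: E_def fH)
    have good: "run (D i w) y = x ! i" if w: "w \<in> R i" "w \<notin> E 0" "w \<notin> E 1" "w \<notin> E 2" for w
    proof -
      have y: "y ! h (Q i l w) = odd (\<Sum>j<n. of_bool (x ! j \<and> F j (Q i l w)) :: nat)"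
        if l: "l < 3" for l
      proof -
        have "w \<notin> E l" using l w by (auto simp: less_Suc_eq eval_nat_numeral)
        then have "y ! h (Q i l w) = C x ! h (Q i l w)"
          using w(1) hQ[OF i l w(1)] by (auto simp: E_def H_def)
        then show ?thesis using hQ[OF i l w(1)] by (simp add: C_def)
      qed
      define S where "S l = (\<Sum>j<n. of_bool (x ! j \<and> F j (Q i l w)) :: nat)" for l
      have "(\<Sum>l<3. S l) = S 0 + S 1 + S 2" by (simp add: numeral_3_eq_3 numeral_2_eq_2)
      then have "run (D i w) y = odd (\<Sum>l<3. S l)"
        using y[of 0, folded S_def] y[of 1, folded S_def] y[of 2, folded S_def]
        by (auto simp: D_def)
      also have "(\<Sum>l<3. S l) = (\<Sum>l<3. \<Sum>j<n. of_bool (x ! j \<and> F j (Q i l w)))"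
        by (simp only: S_def)
      also have "\<dots> = (\<Sum>j<n. of_bool (x ! j) * (\<Sum>l<3. of_bool (F j (Q i l w))))"
        by (subst sum.swap) (simp only: of_bool_conj sum_distrib_left)
      \<comment> \<open>A sum has the parity of its number of odd terms; by \<open>F\<close> only
        \<open>j = i\<close> can give an odd one, and it does exactly when \<open>x ! i\<close>
        holds.\<close>
      also have "odd \<dots> \<longleftrightarrow> odd (card {j \<in> {..<n}. odd (of_bool (x ! j) * (\<Sum>l<3. of_bool (F j (Q i l w))) :: nat)})"
        by (simp only: even_sum_iff[OF finite_lessThan])
      also have "{j \<in> {..<n}. odd (of_bool (x ! j) * (\<Sum>l<3. of_bool (F j (Q i l w))) :: nat)}
        = (if x ! i then {i} else {})"
        using F[OF i _ w(1)] i by (auto simp del: even_sum_iff)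
      finally show ?thesis by simp
    qed
    have c0: "card (R i) > 0" using fR[OF i] by (simp add: card_gt_0_iff)
    have "R i - {w. run (D i w) y = x ! i} \<subseteq> E 0 \<union> E 1 \<union> E 2" using good by blast
    then have "card (R i - {w. run (D i w) y = x ! i}) \<le> card (E 0 \<union> E 1 \<union> E 2)"
      using fR[OF i] by (intro card_mono) (auto simp: E_def)
    also have "\<dots> \<le> card (E 0) + card (E 1) + card (E 2)"
      by (meson add_right_mono card_Un_le order_trans)
    also have "\<dots> \<le> 3 * card H" using cE[of 0] cE[of 1] cE[of 2] by simp
    finally have "real (card (R i - {w. run (D i w) y = x ! i})) \<le> 3 * real (card H)" by linarith
    also have "\<dots> \<le> 3 * (1 / (12 * real p) * real N)" using d cH by simp
    also have "\<dots> \<le> 3 * (1 / (12 * real p) * (real p * real (card (R i))))"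
      using R(2)[OF i] unfolding N_def
      by (intro mult_left_mono) (simp_all flip: of_nat_mult)
    also have "\<dots> = real (card (R i)) / 4" using p by simp
    finally have bad: "real (card (R i - {w. run (D i w) y = x ! i})) \<le> real (card (R i)) / 4" .
    have "card (R i) = card (R i \<inter> {w. run (D i w) y = x ! i}) + card (R i - {w. run (D i w) y = x ! i})"
      using fR[OF i] by (metis Diff_Int2 Int_Diff_Un Int_Diff_disjoint card_Un_disjoint finite_Diff finite_Int)
    then have "real (card (R i \<inter> {w. run (D i w) y = x ! i})) \<ge> 3 / 4 * real (card (R i))"
      using bad by linarith
    then have "3 / 4 \<le> real (card (R i \<inter> {w. run (D i w) y = x ! i})) / real (card (R i))"
      using c0 by (simp add: field_simps)
    also have "\<dots> = measure_pmf.prob (A i) {T. run T y = x ! i}"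
      unfolding A_def measure_map_pmf using fR[OF i] by (simp add: measure_pmf_of_set vimage_def)
    finally show ?thesis by simp
  qed
  ultimately have "locally_decodable n N C 3 (1 / (12 * real p)) (1 / 4)"
    unfolding locally_decodable_def by blast
  moreover have "C \<in> bitstrings n \<rightarrow> bitstrings N"
    by (simp add: C_def bitstrings_def)
  ultimately show ?thesis unfolding N_def by blast
qed

section \<open>Vectors with prescribed inner products, and the code length\<close>

theorem theorem12:
  fixes t :: nat
  assumes "t > 0"
    and "real (largest_prime_factor (2 ^ t - 1)) > 2 powr (0.75 * real t)"
  shows "\<exists>(c::real) (\<delta>::real) (\<epsilon>::real). c > 0 \<and> \<delta> > 0 \<and> \<epsilon> < 1 / 2 \<and>
    (\<forall>n::nat. n \<ge> 1 \<longrightarrow>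
      (\<exists>(N::nat) (C :: bool list \<Rightarrow> bool list).
        C \<in> bitstrings n \<rightarrow> bitstrings N \<and>
        real N \<le> exp (c * real n powr (1 / real t)) \<and>
        locally_decodable n N C 3 \<delta> \<epsilon>))"
proof -
  define p where "p = largest_prime_factor (2 ^ t - 1)"
  \<comment> \<open>This excludes the default value 1 of
    \<open>largest_prime_factor\<close>.\<close>
  have "1 \<le> 2 powr (0.75 * real t)" by (intro ge_one_powr_ge_zero) auto
  then have "p \<noteq> 1" using assms(2) by (auto simp: p_def)
  then have "p \<in> prime_factors (2 ^ t - 1)"
    unfolding p_def largest_prime_factor_def
    using Max_in[OF finite_set_mset, of "prime_factorization (2 ^ t - 1 :: nat)"]
    by (auto split: if_splits)
  then have p: "prime p" "p dvd 2 ^ t - 1" by auto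
  have p1: "p > 1" using p prime_gt_1_nat by blast
  have "real ((2 ^ t) ^ 3) = (2 powr (0.75 * real t)) ^ 4"
    by (simp add: powr_powr mult.commute flip: powr_realpow)
  also have "\<dots> < real p ^ 4" using assms(2) unfolding p_def by (intro power_strict_mono) auto
  finally have large: "(2 ^ t) ^ 3 < p ^ 4" by (metis of_nat_less_iff of_nat_power)
  obtain f and s :: "nat \<Rightarrow> nat" where f: "f 0" "\<And>m n. [m = n] (mod p) \<Longrightarrow> f m = f n"
    "\<And>a k. even (\<Sum>l<3. of_bool (f (a + 2 ^ k * s l)) :: nat)"
    using exists_parity_function[OF p assms(1) large] by blast
  have ord: "ord p 2 = t" using p(2) assms(1) large by (rule ord_two_of_large_mersenne_divisor)
  then have cop: "coprime p 2" using assms(1) ord_gt_0_iff[of p 2] by simp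
  have "t dvd p - 1"
    using order_divides_totient[OF cop] totient_prime[OF p(1)] ord by simp
  then obtain e where e: "p - 1 = e * t" by (metis dvd_def mult.commute)
  have e0: "e > 0" using e p1 by (cases e) auto
  have pow: "\<exists>k. [x ^ e = 2 ^ k] (mod p)" if "\<not> p dvd x" for x
    using power_cong_power_of_base[OF p(1) cop _ that] e ord by simp
  have decodable: "\<exists>C. C \<in> bitstrings n \<rightarrow> bitstrings (p ^ (((p - 1) * r) ^ e)) \<and>
    locally_decodable n (p ^ (((p - 1) * r) ^ e)) C 3 (1 / (12 * real p)) (1 / 4)"
    if n: "n \<ge> 1" "n \<le> r ^ (p - 1)" for n r
  proof -
    note p = p1 and e = e0
    \<comment> \<open>Word length \<open>p - 1\<close> keeps the distance of distinct words strictly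
      between 0 and \<open>p\<close>.\<close>
    define P where "P = PiE {..<p - 1} (\<lambda>_. {..<r})"
    have "card {..<n} \<le> card P" using n by (simp add: P_def card_PiE)
    moreover have "finite P" by (auto simp: P_def intro!: finite_PiE)
    ultimately obtain a where a: "inj_on a {..<n}" "a ` {..<n} \<subseteq> P"
      using card_le_inj[of "{..<n}" P] by auto
    have ar: "a i l < r" if "i < n" "l < p - 1" for i l
      using a(2) that by (auto simp: P_def PiE_iff)
    define B where "B = {..<p - 1} \<times> {..<r}"
    define D where "D = PiE {..<e} (\<lambda>_. B)"
    have fB: "finite B" by (simp add: B_def)
    have fD: "finite D" using fB by (auto simp: D_def intro!: finite_PiE)
    have cD: "card D = ((p - 1) * r) ^ e" by (simp add: D_def B_def card_PiE card_cartesian_product)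
    \<comment> \<open>\<open>U i\<close> is the \<open>e\<close>-th tensor power of the indicator of
      the graph of the word \<open>a i\<close>, and \<open>V i\<close> that of its complement.
      Before taking powers, the inner product is the Hamming distance
      \<open>\<delta> i j\<close>.\<close>
    define U where "U i d = (\<Prod>x<e. of_bool (a i (fst (d x)) = snd (d x)) :: nat)" for i d
    define V where "V i d = (\<Prod>x<e. of_bool (a i (fst (d x)) \<noteq> snd (d x)) :: nat)" for i d
    define \<delta> where "\<delta> i j = card {l. l < p - 1 \<and> a i l \<noteq> a j l}" for i j
    have UV: "(\<Sum>d\<in>D. U j d * V i d) = \<delta> i j ^ e" if ij: "i < n" "j < n" for i j
    proof -
      have "(\<Sum>d\<in>D. U j d * V i d)
        = (\<Sum>d\<in>D. \<Prod>x<e. of_bool (a j (fst (d x)) = snd (d x)) * of_bool (a i (fst (d x)) \<noteq> snd (d x)))"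
        by (simp add: U_def V_def prod.distrib)
      also have "\<dots> = (\<Prod>x<e. \<Sum>b\<in>B. of_bool (a j (fst b) = snd b) * of_bool (a i (fst b) \<noteq> snd b))"
        unfolding D_def using fB by (subst prod_sum_PiE) auto
      also have "(\<Sum>b\<in>B. of_bool (a j (fst b) = snd b) * of_bool (a i (fst b) \<noteq> snd b))
        = (\<Sum>l<p - 1. \<Sum>c<r. of_bool (a j l = c) * of_bool (a i l \<noteq> c) :: nat)"
        by (simp only: B_def sum.cartesian_product case_prod_unfold)
      also have "\<dots> = (\<Sum>l<p - 1. of_bool (a i l \<noteq> a j l))"
      proof (intro sum.cong refl)
        fix l assume l: "l \<in> {..<p - 1}"
        have "(\<Sum>c<r. of_bool (a j l = c) * of_bool (a i l \<noteq> c) :: nat)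
          = (\<Sum>c<r. if c = a j l then of_bool (a i l \<noteq> a j l) else 0)"
          by (intro sum.cong) auto
        also have "\<dots> = of_bool (a i l \<noteq> a j l)" using ar[OF ij(2)] l by simp
        finally show "(\<Sum>c<r. of_bool (a j l = c) * of_bool (a i l \<noteq> c) :: nat) = of_bool (a i l \<noteq> a j l)" .
      qed
      also have "\<dots> = \<delta> i j"
        by (simp add: \<delta>_def of_bool_def sum.If_cases Int_def)
      finally show ?thesis by simp
    qed
    have \<delta>0: "\<delta> i i = 0" for i by (simp add: \<delta>_def)
    have \<delta>1: "\<not> p dvd \<delta> i j" if ij: "i < n" "j < n" "i \<noteq> j" for i j
    proof -
      have "a i \<noteq> a j" using a(1) ij by (auto simp: inj_on_def)
      moreover have "a i \<in> P" "a j \<in> P" using a(2) ij by auto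
      ultimately obtain l where "l < p - 1" "a i l \<noteq> a j l"
        by (metis PiE_ext P_def lessThan_iff)
      then have "{l. l < p - 1 \<and> a i l \<noteq> a j l} \<noteq> {}" by blast
      then have "\<delta> i j > 0" by (simp add: \<delta>_def card_gt_0_iff)
      moreover have "\<delta> i j \<le> card {..<p - 1}" unfolding \<delta>_def by (intro card_mono) auto
      then have "\<delta> i j < p" using p by simp
      ultimately show ?thesis by (simp add: nat_dvd_not_less)
    qed
    define W where "W = PiE D (\<lambda>_. {..<p})"
    have fW: "finite W" using fD by (auto simp: W_def intro!: finite_PiE)
    have cW: "card W = p ^ (((p - 1) * r) ^ e)" using fD by (simp add: W_def card_PiE cD)
    define ip where "ip j w = (\<Sum>d\<in>D. U j d * w d)" for j :: nat and w :: "(nat \<Rightarrow> nat \<times> nat) \<Rightarrow> nat"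
    define R where "R i = {w \<in> W. p dvd ip i w}" for i
    define Q where "Q i l w = restrict (\<lambda>d. (w d + s l * V i d) mod p) D" for i l w
    have QW: "Q i l w \<in> W" for i l w using p by (auto simp: Q_def W_def)
    have ipQ: "[ip j (Q i l w) = ip j w + \<delta> i j ^ e * s l] (mod p)" if "i < n" "j < n" for i j l w
    proof -
      have "[ip j (Q i l w) = (\<Sum>d\<in>D. U j d * (w d + s l * V i d))] (mod p)"
        unfolding ip_def by (intro cong_sum cong_scalar_left) (simp add: Q_def)
      also have "(\<Sum>d\<in>D. U j d * (w d + s l * V i d)) = ip j w + s l * (\<Sum>d\<in>D. U j d * V i d)"
        by (simp add: ip_def distrib_left sum.distrib sum_distrib_left mult.left_commute)
      finally show ?thesis using that by (simp add: UV mult.commute)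
    qed
    have "\<exists>C. C \<in> bitstrings n \<rightarrow> bitstrings (card W) \<and>
      locally_decodable n (card W) C 3 (1 / (12 * real p)) (1 / 4)"
    proof (rule locally_decodable_of_smooth_parity_checks[where F = "\<lambda>j w. f (ip j w)" and Q = Q and R = R])
      show "W \<noteq> {}" using QW by blast
      show "R i \<subseteq> W" for i by (auto simp: R_def)
      show "Q i l w \<in> W" for i l w by (rule QW)
      show "inj_on (Q i l) (R i)" for i l
      proof (rule inj_onI)
        fix w w' assume w: "w \<in> R i" "w' \<in> R i" "Q i l w = Q i l w'"
        show "w = w'"
        proof (rule PiE_ext)
          show "w \<in> PiE D (\<lambda>_. {..<p})" "w' \<in> PiE D (\<lambda>_. {..<p})"
            using w by (auto simp: R_def W_def)
          fix d assume d: "d \<in> D"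
          have "(w d + s l * V i d) mod p = (w' d + s l * V i d) mod p"
            using fun_cong[OF w(3), of d] d by (simp add: Q_def)
          then have "[w d = w' d] (mod p)" by (simp only: cong_add_rcancel_nat flip: cong_mod_def)
          moreover have "w d < p" "w' d < p" using w d by (auto simp: R_def W_def PiE_iff)
          ultimately show "w d = w' d" by (rule cong_less_modulus_unique_nat)
        qed
      qed
      show "card W \<le> p * card (R i)" if i: "i < n" for i
      proof -
        \<comment> \<open>A coordinate where \<open>U i\<close> is 1: all its entries point to the
          first letter of \<open>a i\<close>.\<close>
        define d0 where "d0 = restrict (\<lambda>_. (0 :: nat, a i 0)) {..<e}"
        have d0: "d0 \<in> D" "U i d0 = 1"
          using ar[OF i, of 0] p by (auto simp: d0_def D_def B_def U_def)
        \<comment> \<open>With \<open>p - 1\<close> acting as -1, changing coordinate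
          \<open>d0\<close> makes the inner product vanish modulo \<open>p\<close>; recording the
          old value keeps \<open>\<phi>\<close> injective.\<close>
        define \<phi> where "\<phi> w = (w(d0 := (w d0 + (p - 1) * ip i w) mod p), w d0)" for w
        have "card W \<le> card (R i \<times> {..<p})"
        proof (rule card_inj_on_le)
          show "inj_on \<phi> W"
          proof (intro inj_onI ext)
            fix w w' d assume "\<phi> w = \<phi> w'"
            then have eq: "w(d0 := (w d0 + (p - 1) * ip i w) mod p) = w'(d0 := (w' d0 + (p - 1) * ip i w') mod p)"
              "w d0 = w' d0" by (auto simp only: \<phi>_def prod.inject)
            show "w d = w' d" using fun_cong[OF eq(1), of d] eq(2) by (cases "d = d0") auto
          qed
          show "\<phi> ` W \<subseteq> R i \<times> {..<p}"
          proof
            fix z assume "z \<in> \<phi> ` W"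
            then obtain w where w: "w \<in> W" "z = \<phi> w" by blast
            define v where "v = w(d0 := (w d0 + (p - 1) * ip i w) mod p)"
            have "v \<in> W" using w(1) d0 p by (auto simp: v_def W_def PiE_iff extensional_def)
            have "ip i v = v d0 + (\<Sum>d\<in>D - {d0}. U i d * v d)"
              unfolding ip_def using d0 fD by (simp add: sum.remove)
            also have "\<dots> = v d0 + (\<Sum>d\<in>D - {d0}. U i d * w d)"
              by (simp add: v_def)
            also have "[\<dots> = (w d0 + (p - 1) * ip i w) + (\<Sum>d\<in>D - {d0}. U i d * w d)] (mod p)"
              by (intro cong_add) (simp_all add: v_def)
            also have "(w d0 + (p - 1) * ip i w) + (\<Sum>d\<in>D - {d0}. U i d * w d) = ip i w + (p - 1) * ip i w"
              unfolding ip_def using d0 fD by (simp add: sum.remove)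
            also have "\<dots> = p * ip i w" using p by (simp add: mult_eq_if)
            finally have "p dvd ip i v" by (simp add: cong_dvd_iff)
            then have "v \<in> R i" using \<open>v \<in> W\<close> by (simp add: R_def)
            moreover have "w d0 < p" using w(1) d0 by (auto simp: W_def PiE_iff)
            ultimately show "z \<in> R i \<times> {..<p}" using w(2) by (simp add: \<phi>_def v_def)
          qed
          show "finite (R i \<times> {..<p})" using fW by (simp add: R_def)
        qed
        then show ?thesis by (simp add: card_cartesian_product mult.commute)
      qed
      show "odd (\<Sum>l<3. of_bool (f (ip j (Q i l w))) :: nat) \<longleftrightarrow> i = j"
        if ij: "i < n" "j < n" "w \<in> R i" for i j w
      proof (cases "i = j")
        case True
        \<comment> \<open>All three points stay orthogonal to \<open>U i\<close> modulo
          \<open>p\<close>, so \<open>f\<close> takes the value \<open>f 0\<close> three times, an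
          odd number.\<close>
        have "f (ip j (Q i l w))" for l
        proof -
          have "[ip j (Q i l w) = 0] (mod p)"
            using ipQ[OF ij(1,2), of l w] ij(3) e True
            by (auto simp: \<delta>0 R_def power_0_left cong_0_iff cong_dvd_iff)
          from f(2)[OF this] show ?thesis using f(1) by simp
        qed
        then show ?thesis using True by simp
      next
        case False
        then obtain k where k: "[\<delta> i j ^ e = 2 ^ k] (mod p)" using pow[OF \<delta>1[OF ij(1,2) False]] by blast
        have "f (ip j (Q i l w)) = f (ip j w + 2 ^ k * s l)" for l
          by (intro f(2) cong_trans[OF ipQ[OF ij(1,2)]] cong_add cong_mult k cong_refl)
        then show ?thesis using f(3)[of "ip j w" k] False by simp
      qed
    qed (use fW p in auto)
    then show ?thesis by (simp add: cW)
  qed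
  \<comment> \<open>With \<open>b = n^(1/(p - 1))\<close> one has \<open>b^e = n^(1/t)\<close>,
    because \<open>p - 1 = e * t\<close>. Rounding \<open>b \<ge> 1\<close> up to \<open>r\<close>
    at most doubles it, which accounts for the factor 2.\<close>
  define c where "c = ln (real p) * (2 * real (p - 1)) ^ e"
  have "c > 0" using p1 by (simp add: c_def)
  moreover have "\<exists>N C. C \<in> bitstrings n \<rightarrow> bitstrings N \<and>
      real N \<le> exp (c * real n powr (1 / real t)) \<and>
      locally_decodable n N C 3 (1 / (12 * real p)) (1 / 4)" if n: "n \<ge> 1" for n
  proof -
    define b where "b = real n powr (1 / real (p - 1))"
    define r where "r = nat \<lceil>b\<rceil>"
    have b1: "b \<ge> 1" unfolding b_def using n by (intro ge_one_powr_ge_zero) auto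
    have rb: "b \<le> real r" "real r \<le> 2 * b" using b1 unfolding r_def by linarith+
    have "real n = b ^ (p - 1)"
      using n p1 by (simp add: b_def powr_powr flip: powr_realpow)
    also have "\<dots> \<le> real r ^ (p - 1)" using rb b1 by (intro power_mono) auto
    finally have "n \<le> r ^ (p - 1)" by (metis of_nat_le_iff of_nat_power)
    from decodable[OF n this]
    obtain C where C: "C \<in> bitstrings n \<rightarrow> bitstrings (p ^ (((p - 1) * r) ^ e))"
      "locally_decodable n (p ^ (((p - 1) * r) ^ e)) C 3 (1 / (12 * real p)) (1 / 4)" by blast
    have "real (p - 1) = real e * real t" by (simp only: e of_nat_mult)
    then have "1 / real (p - 1) * real e = 1 / real t" using e0 by (simp only:) simp
    moreover have "b ^ e = b powr real e" using b1 by (simp add: powr_realpow)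
    ultimately have "b ^ e = real n powr (1 / real t)" by (simp only: b_def powr_powr)
    moreover have "real (((p - 1) * r) ^ e) \<le> (2 * real (p - 1) * b) ^ e"
    proof -
      have "real (p - 1) * real r \<le> real (p - 1) * (2 * b)" using rb by (intro mult_left_mono) auto
      then have "(real (p - 1) * real r) ^ e \<le> (2 * real (p - 1) * b) ^ e"
        by (intro power_mono) (simp_all only: mult_ac of_nat_0_le_iff mult_nonneg_nonneg)
      then show ?thesis by (simp only: of_nat_power of_nat_mult)
    qed
    ultimately have "real (((p - 1) * r) ^ e) \<le> (2 * real (p - 1)) ^ e * real n powr (1 / real t)"
      by (simp only: power_mult_distrib)
    then have "ln (real p) * real (((p - 1) * r) ^ e) \<le> c * real n powr (1 / real t)"
      using p1 unfolding c_def by (simp only: mult.assoc) (intro mult_left_mono, auto)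
    moreover have "real (p ^ m) = exp (ln (real p) * real m)" for m
      using p1 by (simp add: exp_of_nat2_mult)
    ultimately show ?thesis using C by (metis exp_le_cancel_iff)
  qed
  ultimately show ?thesis
    using p1 by (intro exI[of _ c] exI[of _ "1 / (12 * real p)"] exI[of _ "1 / 4 :: real"]) auto
qed

end
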